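(* Let $R$ be a Dedekind domain and let $I$ be a nonzero ideal of $R$ such that $R/I$ is finite and nontrivial. The graph $G_{R/I}$ is bipartite if and only if $Q(I)=2$.
   Context: $G_{R/I}$ is the unitary Cayley graph of $R/I$: vertex set $R/I$, with $a+I$, $b+I$ adjacent iff $a-b+I$ is a unit of $R/I$. $Q(I)$ is the minimum of $|R/P|$ over all prime ideals $P$ dividing $I$. *)

theory Defs
  imports "Graph_Theory.Pair_Digraph" "HOL-Algebra.Algebra"
begin

section \<open>Fraction field of a domain\<close>

text \<open>The fraction \<open>a / b\<close> is the class of all pairs \<open>(c, d)\<close> with \<open>a d = c b\<close>.\<close>

definition fraction :: "('a, 'm) ring_scheme \<Rightarrow> 'a \<Rightarrow> 'a \<Rightarrow> ('a \<times> 'a) set"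
  where "fraction R a b =
    {(c, d). c \<in> carrier R \<and> d \<in> carrier R - {\<zero>\<^bsub>R\<^esub>} \<and> a \<otimes>\<^bsub>R\<^esub> d = c \<otimes>\<^bsub>R\<^esub> b}"

text \<open>The unions below range over all representatives of the two operands; in a domain every
  choice of representatives contributes the same class (\<open>fraction_mult\<close>, \<open>fraction_add\<close>).\<close>

definition fraction_field :: "('a, 'm) ring_scheme \<Rightarrow> ('a \<times> 'a) set ring"
  where "fraction_field R =
    \<lparr> carrier = {fraction R a b | a b. a \<in> carrier R \<and> b \<in> carrier R - {\<zero>\<^bsub>R\<^esub>}},
      mult = (\<lambda>A B. \<Union>(a, b)\<in>A. \<Union>(c, d)\<in>B. fraction R (a \<otimes>\<^bsub>R\<^esub> c) (b \<otimes>\<^bsub>R\<^esub> d)),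
      one = fraction R \<one>\<^bsub>R\<^esub> \<one>\<^bsub>R\<^esub>,
      ring.zero = fraction R \<zero>\<^bsub>R\<^esub> \<one>\<^bsub>R\<^esub>,
      ring.add = (\<lambda>A B. \<Union>(a, b)\<in>A. \<Union>(c, d)\<in>B.
        fraction R ((a \<otimes>\<^bsub>R\<^esub> d) \<oplus>\<^bsub>R\<^esub> (c \<otimes>\<^bsub>R\<^esub> b)) (b \<otimes>\<^bsub>R\<^esub> d)) \<rparr>"

definition to_fraction :: "('a, 'm) ring_scheme \<Rightarrow> 'a \<Rightarrow> ('a \<times> 'a) set"
  where "to_fraction R a = fraction R a \<one>\<^bsub>R\<^esub>"

context domain
begin

lemma fraction_eq_iff:
  assumes "a \<in> carrier R" "b \<in> carrier R - {\<zero>}" "c \<in> carrier R" "d \<in> carrier R - {\<zero>}"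
  shows "fraction R a b = fraction R c d \<longleftrightarrow> a \<otimes> d = c \<otimes> b"
proof
  assume eq: "fraction R a b = fraction R c d"
  have "(c, d) \<in> fraction R c d"
    using assms by (simp add: fraction_def)
  then show "a \<otimes> d = c \<otimes> b"
    using eq by (auto simp: fraction_def)
next
  have sub: "fraction R a b \<subseteq> fraction R c d"
    if a: "a \<in> carrier R" and b: "b \<in> carrier R - {\<zero>}" and c: "c \<in> carrier R"
      and d: "d \<in> carrier R - {\<zero>}" and eq: "a \<otimes> d = c \<otimes> b" for a b c d
  proof (clarsimp simp: fraction_def)
    fix x y
    assume x: "x \<in> carrier R" and y: "y \<in> carrier R" "y \<noteq> \<zero>" and xy: "a \<otimes> y = x \<otimes> b"
    have "b \<otimes> (c \<otimes> y) = (c \<otimes> b) \<otimes> y"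
      using b c y by (simp add: m_ac)
    also have "\<dots> = (a \<otimes> y) \<otimes> d"
      using a d y by (simp add: m_ac flip: eq)
    also have "\<dots> = b \<otimes> (x \<otimes> d)"
      using b d x by (simp add: m_ac xy)
    finally show "c \<otimes> y = x \<otimes> d"
      using b c d x y m_lcancel[of b "c \<otimes> y" "x \<otimes> d"] by auto
  qed
  assume "a \<otimes> d = c \<otimes> b"
  then show "fraction R a b = fraction R c d"
    using sub[of a b c d] sub[of c d a b] assms by (intro equalityI) auto
qed

lemma fraction_mem:
  assumes "a \<in> carrier R" "b \<in> carrier R - {\<zero>}"
  shows "(a, b) \<in> fraction R a b"
  using assms by (simp add: fraction_def)

lemma fraction_mult:
  assumes "a \<in> carrier R" "b \<in> carrier R - {\<zero>}" "c \<in> carrier R" "d \<in> carrier R - {\<zero>}"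
  shows "fraction R a b \<otimes>\<^bsub>fraction_field R\<^esub> fraction R c d = fraction R (a \<otimes> c) (b \<otimes> d)"
proof -
  have "fraction R (a' \<otimes> c') (b' \<otimes> d') = fraction R (a \<otimes> c) (b \<otimes> d)"
    if "(a', b') \<in> fraction R a b" "(c', d') \<in> fraction R c d" for a' b' c' d'
  proof -
    from that have *: "a' \<in> carrier R" "b' \<in> carrier R" "b' \<noteq> \<zero>" "c' \<in> carrier R"
      "d' \<in> carrier R" "d' \<noteq> \<zero>" and e: "a \<otimes> b' = a' \<otimes> b" "c \<otimes> d' = c' \<otimes> d"
      by (auto simp: fraction_def)
    have "(a' \<otimes> c') \<otimes> (b \<otimes> d) = (a' \<otimes> b) \<otimes> (c' \<otimes> d)"
      using * assms by (simp add: m_ac)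
    also have "\<dots> = (a \<otimes> b') \<otimes> (c \<otimes> d')"
      by (simp add: e)
    also have "\<dots> = (a \<otimes> c) \<otimes> (b' \<otimes> d')"
      using * assms by (simp add: m_ac)
    finally show ?thesis
      using * assms by (subst fraction_eq_iff) (auto simp: integral_iff)
  qed
  then have "(\<Union>(a', b')\<in>fraction R a b. \<Union>(c', d')\<in>fraction R c d.
      fraction R (a' \<otimes> c') (b' \<otimes> d')) =
    (\<Union>_\<in>fraction R a b. \<Union>_\<in>fraction R c d. fraction R (a \<otimes> c) (b \<otimes> d))"
    by (intro SUP_cong refl) (simp only: split_paired_all prod.case, intro SUP_cong refl, auto)
  moreover have "fraction R a b \<noteq> {}" "fraction R c d \<noteq> {}"
    using fraction_mem[OF assms(1,2)] fraction_mem[OF assms(3,4)] by blast+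
  ultimately show ?thesis
    by (simp add: fraction_field_def)
qed

lemma fraction_add:
  assumes "a \<in> carrier R" "b \<in> carrier R - {\<zero>}" "c \<in> carrier R" "d \<in> carrier R - {\<zero>}"
  shows "fraction R a b \<oplus>\<^bsub>fraction_field R\<^esub> fraction R c d =
    fraction R ((a \<otimes> d) \<oplus> (c \<otimes> b)) (b \<otimes> d)"
proof -
  have "fraction R ((a' \<otimes> d') \<oplus> (c' \<otimes> b')) (b' \<otimes> d') =
      fraction R ((a \<otimes> d) \<oplus> (c \<otimes> b)) (b \<otimes> d)"
    if "(a', b') \<in> fraction R a b" "(c', d') \<in> fraction R c d" for a' b' c' d'
  proof -
    from that have *: "a' \<in> carrier R" "b' \<in> carrier R" "b' \<noteq> \<zero>" "c' \<in> carrier R"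
      "d' \<in> carrier R" "d' \<noteq> \<zero>" and e: "a \<otimes> b' = a' \<otimes> b" "c \<otimes> d' = c' \<otimes> d"
      by (auto simp: fraction_def)
    have "((a' \<otimes> d') \<oplus> (c' \<otimes> b')) \<otimes> (b \<otimes> d) =
        (a' \<otimes> b) \<otimes> (d' \<otimes> d) \<oplus> (c' \<otimes> d) \<otimes> (b' \<otimes> b)"
      using * assms by (simp add: l_distr r_distr m_ac)
    also have "\<dots> = (a \<otimes> b') \<otimes> (d' \<otimes> d) \<oplus> (c \<otimes> d') \<otimes> (b' \<otimes> b)"
      by (simp add: e)
    also have "\<dots> = ((a \<otimes> d) \<oplus> (c \<otimes> b)) \<otimes> (b' \<otimes> d')"
      using * assms by (simp add: l_distr r_distr m_ac)
    finally show ?thesis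
      using * assms by (subst fraction_eq_iff) (auto simp: integral_iff)
  qed
  then have "(\<Union>(a', b')\<in>fraction R a b. \<Union>(c', d')\<in>fraction R c d.
      fraction R ((a' \<otimes> d') \<oplus> (c' \<otimes> b')) (b' \<otimes> d')) =
    (\<Union>_\<in>fraction R a b. \<Union>_\<in>fraction R c d. fraction R ((a \<otimes> d) \<oplus> (c \<otimes> b)) (b \<otimes> d))"
    by (intro SUP_cong refl) (simp only: split_paired_all prod.case, intro SUP_cong refl, auto)
  moreover have "fraction R a b \<noteq> {}" "fraction R c d \<noteq> {}"
    using fraction_mem[OF assms(1,2)] fraction_mem[OF assms(3,4)] by blast+
  ultimately show ?thesis
    by (simp add: fraction_field_def)
qed

lemma fraction_carrierE:
  assumes "x \<in> carrier (fraction_field R)"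
  obtains a b where "a \<in> carrier R" "b \<in> carrier R" "b \<noteq> \<zero>" "x = fraction R a b"
  using assms by (auto simp: fraction_field_def)

lemma fraction_carrier:
  assumes "a \<in> carrier R" "b \<in> carrier R" "b \<noteq> \<zero>"
  shows "fraction R a b \<in> carrier (fraction_field R)"
  using assms by (auto simp: fraction_field_def)

lemma fraction_field_one: "\<one>\<^bsub>fraction_field R\<^esub> = fraction R \<one> \<one>"
  and fraction_field_zero: "\<zero>\<^bsub>fraction_field R\<^esub> = fraction R \<zero> \<one>"
  by (simp_all add: fraction_field_def)

lemmas fraction_simps = fraction_mult fraction_add fraction_eq_iff fraction_carrier
  fraction_field_one fraction_field_zero integral_iff

lemma fraction_field_is_field: "field (fraction_field R)"
proof -
  let ?K = "fraction_field R"
  have "abelian_group ?K"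
  proof (rule abelian_groupI)
    fix x y assume "x \<in> carrier ?K" "y \<in> carrier ?K"
    then show "x \<oplus>\<^bsub>?K\<^esub> y \<in> carrier ?K"
      by (elim fraction_carrierE) (simp add: fraction_simps)
  next
    fix x y assume "x \<in> carrier ?K" "y \<in> carrier ?K"
    then show "x \<oplus>\<^bsub>?K\<^esub> y = y \<oplus>\<^bsub>?K\<^esub> x"
      by (elim fraction_carrierE) (simp add: fraction_simps a_comm m_comm)
  next
    fix x y z assume "x \<in> carrier ?K" "y \<in> carrier ?K" "z \<in> carrier ?K"
    then show "x \<oplus>\<^bsub>?K\<^esub> y \<oplus>\<^bsub>?K\<^esub> z = x \<oplus>\<^bsub>?K\<^esub> (y \<oplus>\<^bsub>?K\<^esub> z)"
      by (elim fraction_carrierE) (simp add: fraction_simps l_distr r_distr a_ac m_ac)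
  next
    fix x assume "x \<in> carrier ?K"
    then obtain a b where x: "a \<in> carrier R" "b \<in> carrier R" "b \<noteq> \<zero>" "x = fraction R a b"
      by (rule fraction_carrierE)
    have "fraction R (\<ominus> a) b \<oplus>\<^bsub>?K\<^esub> x = \<zero>\<^bsub>?K\<^esub>"
      using x by (simp add: fraction_simps l_minus l_neg flip: l_distr)
    moreover have "fraction R (\<ominus> a) b \<in> carrier ?K"
      using x by (simp add: fraction_simps)
    ultimately show "\<exists>y\<in>carrier ?K. y \<oplus>\<^bsub>?K\<^esub> x = \<zero>\<^bsub>?K\<^esub>"
      by blast
  qed (auto simp: fraction_simps elim!: fraction_carrierE)
  moreover have "comm_monoid ?K"
  proof (rule comm_monoidI)
    fix x y assume "x \<in> carrier ?K" "y \<in> carrier ?K"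
    then show "x \<otimes>\<^bsub>?K\<^esub> y \<in> carrier ?K"
      by (elim fraction_carrierE) (simp add: fraction_simps)
  next
    fix x y assume "x \<in> carrier ?K" "y \<in> carrier ?K"
    then show "x \<otimes>\<^bsub>?K\<^esub> y = y \<otimes>\<^bsub>?K\<^esub> x"
      by (elim fraction_carrierE) (simp add: fraction_simps m_comm)
  next
    fix x y z assume "x \<in> carrier ?K" "y \<in> carrier ?K" "z \<in> carrier ?K"
    then show "x \<otimes>\<^bsub>?K\<^esub> y \<otimes>\<^bsub>?K\<^esub> z = x \<otimes>\<^bsub>?K\<^esub> (y \<otimes>\<^bsub>?K\<^esub> z)"
      by (elim fraction_carrierE) (simp add: fraction_simps m_ac)
  qed (auto simp: fraction_simps elim!: fraction_carrierE)
  moreover have "(x \<oplus>\<^bsub>?K\<^esub> y) \<otimes>\<^bsub>?K\<^esub> z = x \<otimes>\<^bsub>?K\<^esub> z \<oplus>\<^bsub>?K\<^esub> y \<otimes>\<^bsub>?K\<^esub> z"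
    if "x \<in> carrier ?K" "y \<in> carrier ?K" "z \<in> carrier ?K" for x y z
    using that by (elim fraction_carrierE) (simp add: fraction_simps l_distr r_distr m_ac)
  ultimately interpret K: cring ?K
    by (rule cringI)
  show ?thesis
  proof (rule K.cring_fieldI2)
    show "\<zero>\<^bsub>?K\<^esub> \<noteq> \<one>\<^bsub>?K\<^esub>"
      by (simp add: fraction_simps)
  next
    fix x assume "x \<in> carrier ?K" "x \<noteq> \<zero>\<^bsub>?K\<^esub>"
    then obtain a b where x: "a \<in> carrier R" "b \<in> carrier R" "b \<noteq> \<zero>" "x = fraction R a b"
      and "a \<noteq> \<zero>"
      by (elim fraction_carrierE) (auto simp: fraction_simps)
    then have "fraction R b a \<in> carrier ?K" "x \<otimes>\<^bsub>?K\<^esub> fraction R b a = \<one>\<^bsub>?K\<^esub>"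
      by (simp_all add: fraction_simps m_comm)
    then show "\<exists>y\<in>carrier ?K. x \<otimes>\<^bsub>?K\<^esub> y = \<one>\<^bsub>?K\<^esub>"
      by blast
  qed
qed

lemma to_fraction_hom: "to_fraction R \<in> ring_hom R (fraction_field R)"
  by (rule ring_hom_memI) (simp_all add: to_fraction_def fraction_simps)

lemma inj_on_to_fraction: "inj_on (to_fraction R) (carrier R)"
  by (rule inj_onI) (simp add: to_fraction_def fraction_simps)

end


section \<open>Dedekind domains\<close>

text \<open>Univariate polynomials of the library are coefficient lists with the leading coefficient
  first, the zero polynomial being the empty list.\<close>

definition integral_over :: "('a, 'm) ring_scheme \<Rightarrow> 'a set \<Rightarrow> 'a \<Rightarrow> bool"
  where "integral_over K S x \<longleftrightarrow>
    (\<exists>p \<in> carrier (univ_poly K S). p \<noteq> [] \<and> lead_coeff p = \<one>\<^bsub>K\<^esub> \<and> ring.eval K p x = \<zero>\<^bsub>K\<^esub>)"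

definition integrally_closed :: "('a, 'm) ring_scheme \<Rightarrow> bool"
  where "integrally_closed R \<longleftrightarrow>
    (\<forall>x \<in> carrier (fraction_field R).
      integral_over (fraction_field R) (to_fraction R ` carrier R) x \<longrightarrow>
        x \<in> to_fraction R ` carrier R)"

text \<open>Fields are not excluded.\<close>

locale dedekind_domain = noetherian_domain +
  assumes integrally_closed: "integrally_closed R"
    and nonzero_prime_maximal: "primeideal P R \<Longrightarrow> P \<noteq> {\<zero>} \<Longrightarrow> maximalideal P R"

text \<open>Divisibility of ideals is divisibility in the multiplicative monoid of ideals:
  \<open>P\<close> divides \<open>I\<close> iff \<open>I = P J\<close> for some ideal \<open>J\<close>.
  An infinite quotient has \<open>card\<close> zero and would spoil the minimum, but this cannot occur
  when \<open>R / I\<close> is finite, because a divisor of \<open>I\<close> contains \<open>I\<close>.\<close>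

definition min_prime_norm :: "('a, 'm) ring_scheme \<Rightarrow> 'a set \<Rightarrow> nat"
  where "min_prime_norm R I =
    (LEAST n. \<exists>P. primeideal P R \<and> P divides\<^bsub>ideals_set R\<^esub> I \<and> n = card (carrier (R Quot P)))"


section \<open>Unitary Cayley graphs\<close>

text \<open>As usual in the graph library, an undirected edge is a pair of opposite arcs.\<close>

definition unitary_cayley_graph :: "('a, 'm) ring_scheme \<Rightarrow> 'a pair_pre_digraph"
  where "unitary_cayley_graph R =
    \<lparr> pverts = carrier R,
      parcs = {(x, y). x \<in> carrier R \<and> y \<in> carrier R \<and> x \<ominus>\<^bsub>R\<^esub> y \<in> Units R} \<rparr>"

definition bipartite :: "('a, 'b) pre_digraph \<Rightarrow> bool"
  where "bipartite G \<longleftrightarrow>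
    (\<exists>U V. verts G = U \<union> V \<and> U \<inter> V = {} \<and>
      (\<forall>e \<in> arcs G. tail G e \<in> U \<and> head G e \<in> V \<or> tail G e \<in> V \<and> head G e \<in> U))"

lemma (in cring) pair_graph_unitary_cayley_graph:
  assumes "finite (carrier R)" "carrier R \<noteq> {\<zero>}"
  shows "pair_graph (unitary_cayley_graph R)"
proof
  let ?G = "unitary_cayley_graph R"
  have neg: "y \<ominus> x \<in> Units R" if xy: "x \<in> carrier R" "y \<in> carrier R" "x \<ominus> y \<in> Units R" for x y
  proof -
    obtain u where u: "u \<in> carrier R" "u \<otimes> (x \<ominus> y) = \<one>"
      using xy(3) by (auto simp: Units_def)
    have "y \<ominus> x = \<ominus> (x \<ominus> y)"
      using xy by (simp add: a_minus_def minus_add a_comm)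
    then have "(\<ominus> u) \<otimes> (y \<ominus> x) = \<one>"
      using u xy by (simp add: l_minus r_minus)
    moreover have "(y \<ominus> x) \<otimes> (\<ominus> u) = \<one>"
      using calculation u xy by (simp add: m_comm)
    ultimately show ?thesis
      using u xy unfolding Units_def by blast
  qed
  show "finite (pverts ?G)"
    using assms(1) by (simp add: unitary_cayley_graph_def)
  have "parcs ?G \<subseteq> carrier R \<times> carrier R"
    by (auto simp: unitary_cayley_graph_def)
  then show "finite (parcs ?G)"
    using assms(1) by (meson finite_SigmaI finite_subset)
  show "symmetric (with_proj ?G)"
    by (auto simp: symmetric_def arcs_ends_def arc_to_ends_def sym_def unitary_cayley_graph_def
        intro: neg)
  fix e assume e: "e \<in> parcs ?G"
  show "fst e \<in> pverts ?G" "snd e \<in> pverts ?G"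
    using e by (auto simp: unitary_cayley_graph_def)
  show "fst e \<noteq> snd e"
  proof
    assume "fst e = snd e"
    then have "\<zero> \<in> Units R"
      using e by (auto simp: unitary_cayley_graph_def a_minus_def r_neg)
    then have "\<one> = \<zero>"
      by (auto simp: Units_def)
    then show False
      using assms(2) one_zeroD by simp
  qed
qed

end

theory Submission
  imports Defs
begin

text \<open>In a Dedekind domain a prime divides \<open>I\<close> iff it contains \<open>I\<close>, and a class is a unit of \<open>R / I\<close> iff
  it lies in no prime containing \<open>I\<close>. If a prime \<open>P\<close> containing \<open>I\<close> has \<open>|R / P| = 2\<close>, then reduction
  modulo \<open>P\<close> is a proper 2-colouring. If every such \<open>P\<close> has a residue field with an element other than
  0 and 1, the Chinese remainder theorem yields \<open>u\<close> with both \<open>u\<close> and \<open>u - 1\<close> units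
  modulo \<open>I\<close>, and the classes of 0, 1 and \<open>u\<close> form a triangle.\<close>

section \<open>Maximal ideals in Noetherian rings\<close>

text \<open>By the Noetherian condition a nonempty chain of ideals contains its own union, so Zorn's
  lemma applies inside any family of ideals. An arbitrary family is allowed because the lemma serves
  both proper ideals and colon ideals.\<close>

lemma (in noetherian_ring) exists_maximal_in_family:
  assumes "C \<noteq> {}" and "\<And>J. J \<in> C \<Longrightarrow> ideal J R"
  obtains M where "M \<in> C" "\<And>J. \<lbrakk> J \<in> C; M \<subseteq> J \<rbrakk> \<Longrightarrow> J = M"
proof -
  have "\<Union>D \<in> C" if "D \<noteq> {}" "subset.chain C D" for D
  proof -
    have "subset.chain {J. ideal J R} D"
      using that(2) assms(2) by (auto simp: subset.chain_def)
    then have "\<Union>D \<in> D"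
      using ideal_chain_is_trivial that(1) by blast
    then show ?thesis
      using that(2) by (auto simp: subset.chain_def)
  qed
  from subset_Zorn_nonempty[OF assms(1) this]
  obtain M where "M \<in> C" "\<forall>J\<in>C. M \<subseteq> J \<longrightarrow> J = M"
    by blast
  then show thesis
    using that by blast
qed

lemma (in noetherian_ring) exists_maximalideal:
  assumes "ideal I R" "I \<noteq> carrier R"
  obtains M where "maximalideal M R" "I \<subseteq> M"
proof -
  let ?C = "{J. ideal J R \<and> I \<subseteq> J \<and> J \<noteq> carrier R}"
  obtain M where M: "M \<in> ?C" "\<And>J. \<lbrakk> J \<in> ?C; M \<subseteq> J \<rbrakk> \<Longrightarrow> J = M"
    by (rule exists_maximal_in_family[of ?C]) (use assms in auto)
  have "maximalideal M R"
  proof (rule maximalidealI)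
    fix J assume "ideal J R" "M \<subseteq> J" "J \<subseteq> carrier R"
    then show "J = M \<or> J = carrier R"
      using M(1) M(2)[of J] by auto
  qed (use M(1) in auto)
  then show thesis
    using that M(1) by blast
qed

lemma (in cring) ideal_add_cgenideal:
  assumes "ideal I R" "x \<in> carrier R"
  shows "ideal (I <+>\<^bsub>R\<^esub> PIdl x) R" "I \<subseteq> I <+>\<^bsub>R\<^esub> PIdl x" "x \<in> I <+>\<^bsub>R\<^esub> PIdl x"
proof -
  have x: "ideal (PIdl x) R" "x \<in> PIdl x"
    using assms(2) cgenideal_ideal cgenideal_self by auto
  interpret I: ideal I R by fact
  interpret X: ideal "PIdl x" R by fact
  show "ideal (I <+>\<^bsub>R\<^esub> PIdl x) R"
    using assms x add_ideals by blast
  show "I \<subseteq> I <+>\<^bsub>R\<^esub> PIdl x"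
  proof
    fix i assume i: "i \<in> I"
    then have "i = i \<oplus> \<zero>" by (simp add: I.Icarr)
    then show "i \<in> I <+>\<^bsub>R\<^esub> PIdl x"
      unfolding set_add_def' using i X.zero_closed by blast
  qed
  have "x = \<zero> \<oplus> x"
    using assms(2) by simp
  then show "x \<in> I <+>\<^bsub>R\<^esub> PIdl x"
    unfolding set_add_def' using x I.zero_closed by blast
qed

lemma (in cring) mem_add_cgenideal:
  "z \<in> I <+>\<^bsub>R\<^esub> PIdl x \<longleftrightarrow> (\<exists>i\<in>I. \<exists>r\<in>carrier R. z = i \<oplus> r \<otimes> x)"
  unfolding set_add_def' cgenideal_def by blast

text \<open>The ideal \<open>P + (e)\<close> is strictly larger than \<open>P\<close>, hence
  contains \<open>\<one>\<close>. The element \<open>r\<close> is an inverse of \<open>e\<close>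
  modulo \<open>P\<close>.\<close>

lemma (in cring) maximalideal_inverse:
  assumes "maximalideal P R" "e \<in> carrier R" "e \<notin> P"
  obtains p r where "p \<in> P" "r \<in> carrier R" "\<one> = p \<oplus> r \<otimes> e"
proof -
  interpret P: maximalideal P R by fact
  let ?J = "P <+>\<^bsub>R\<^esub> PIdl e"
  note J = ideal_add_cgenideal[OF P.is_ideal assms(2)]
  interpret J: ideal ?J R by (rule J(1))
  have "?J = carrier R"
    using P.I_maximal[OF J(1,2)] J(3) assms(3) J.a_subset by blast
  then have "\<one> \<in> ?J" by simp
  then show thesis
    unfolding mem_add_cgenideal using that by blast
qed

section \<open>Prime ideals of Dedekind domains\<close>

text \<open>Bare coefficient lists, leading zeros allowed: equal length aligns the powers of
  \<open>x\<close>, so the sum is taken entry by entry without normalisation.\<close>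

lemma (in ring) eval_map2_add:
  assumes "length p = length q" "set p \<subseteq> carrier R" "set q \<subseteq> carrier R" "x \<in> carrier R"
  shows "eval (map2 (\<oplus>) p q) x = eval p x \<oplus> eval q x"
  using assms
proof (induction p q rule: list_induct2)
  case (Cons a p b q)
  then have "eval p x \<in> carrier R" "eval q x \<in> carrier R" "x [^] length q \<in> carrier R"
    using eval_in_carrier by auto
  then show ?case
    using Cons by (simp add: l_distr a_ac)
qed simp

lemma (in ring) eval_map_mult:
  assumes "set p \<subseteq> carrier R" "x \<in> carrier R" "c \<in> carrier R"
  shows "eval (map ((\<otimes>) c) p) x = c \<otimes> eval p x"
  using assms
proof (induction p)
  case (Cons a p)
  then have "eval p x \<in> carrier R"
    using eval_in_carrier by auto
  then show ?case
    using Cons by (simp add: r_distr m_assoc)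
qed simp

text \<open>As \<open>eval p x\<close> involves only powers of \<open>x\<close> below
  \<open>length p\<close>, moving it to the other side gives a monic relation. The condition
  \<open>\<one> \<noteq> \<zero>\<close> makes the leading coefficient admissible.\<close>

lemma (in ring) integral_overI:
  assumes "subring S R" "set p \<subseteq> S" "x \<in> carrier R" "x [^] length p = eval p x" "\<one> \<noteq> \<zero>"
  shows "integral_over R S x"
proof -
  interpret S: subring S R by fact
  have p: "set p \<subseteq> carrier R"
    using assms(2) S.subset by blast
  let ?q = "\<one> # map ((\<otimes>) (\<ominus> \<one>)) p"
  have "set ?q \<subseteq> S"
    using assms(2) using assms(1) by (auto intro!: subringE(3,5,6))
  then have "?q \<in> carrier (univ_poly R S)"
    using assms(5) by (simp add: polynomial_def flip: univ_poly_carrier)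
  moreover have "eval ?q x = \<zero>"
    using eval_in_carrier[OF p assms(3)] assms(3,4)
    by (simp add: eval_map_mult[OF p] l_minus r_neg)
  ultimately show ?thesis
    unfolding integral_over_def by (metis list.distinct(1) list.sel(1))
qed

text \<open>With \<open>t = b / a\<close> and \<open>0 \<noteq> d \<in> P\<close>, every \<open>d t\<^sup>n\<close> lies in \<open>P\<close>. Stabilisation of the ideals
  \<open>J n = R \<inter> (d R + d t R + \<dots> + d t\<^sup>n\<^sup>-\<^sup>1 R)\<close> makes \<open>t\<close> integral without a determinant argument.\<close>

lemma (in dedekind_domain) multiplier_of_ideal_integral:
  assumes P: "ideal P R" "P \<noteq> {\<zero>}"
    and a: "a \<in> carrier R" "a \<noteq> \<zero>" and b: "b \<in> carrier R"
    and mult: "\<And>p. p \<in> P \<Longrightarrow> \<exists>q\<in>P. b \<otimes> p = a \<otimes> q"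
  shows "\<exists>r\<in>carrier R. b = a \<otimes> r"
proof -
  interpret P: ideal P R by fact
  let ?K = "fraction_field R"
  interpret K: field ?K by (rule fraction_field_is_field)
  define \<phi> where "\<phi> = to_fraction R"
  interpret \<phi>: ring_hom_ring R ?K \<phi>
    unfolding \<phi>_def using to_fraction_hom by (intro ring_hom_ringI2 ring_axioms K.ring_axioms)
  have inj: "x = y" if "\<phi> x = \<phi> y" "x \<in> carrier R" "y \<in> carrier R" for x y
    using that inj_on_to_fraction unfolding \<phi>_def by (meson inj_onD)
  have sub: "subring (\<phi> ` carrier R) ?K"
    using \<phi>.img_is_subring[OF carrier_is_subring] .
  define t where "t = fraction R b a"
  have t: "t \<in> carrier ?K" and at: "\<phi> a \<otimes>\<^bsub>?K\<^esub> t = \<phi> b"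
    using a b by (simp_all add: t_def \<phi>_def to_fraction_def fraction_simps m_ac)
  have \<phi>a: "\<phi> a \<noteq> \<zero>\<^bsub>?K\<^esub>"
    using inj[of a \<zero>] a by auto
  \<comment> \<open>The hypothesis \<open>mult\<close> divided by \<open>a\<close>: multiplication
    by \<open>t\<close> maps the image of \<open>P\<close> into itself.\<close>
  have step: "\<exists>q\<in>P. \<phi> p \<otimes>\<^bsub>?K\<^esub> t = \<phi> q" if p: "p \<in> P" for p
  proof -
    obtain q where q: "q \<in> P" "b \<otimes> p = a \<otimes> q"
      using mult[OF p] by blast
    have c: "p \<in> carrier R" "q \<in> carrier R"
      using p q P.Icarr by auto
    have "\<phi> a \<otimes>\<^bsub>?K\<^esub> (\<phi> p \<otimes>\<^bsub>?K\<^esub> t) = (\<phi> a \<otimes>\<^bsub>?K\<^esub> t) \<otimes>\<^bsub>?K\<^esub> \<phi> p"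
      using a c t by (simp add: K.m_ac)
    also have "\<dots> = \<phi> a \<otimes>\<^bsub>?K\<^esub> \<phi> q"
      using a b c q(2) by (simp add: at flip: \<phi>.hom_mult)
    finally have "\<phi> p \<otimes>\<^bsub>?K\<^esub> t = \<phi> q"
      using K.m_lcancel[OF \<phi>a] a c t by simp
    then show ?thesis
      using q(1) by blast
  qed
  obtain d where d: "d \<in> P" "d \<noteq> \<zero>"
    using P(2) P.zero_closed by blast
  have dR: "d \<in> carrier R"
    using d P.Icarr by blast
  have \<phi>d: "\<phi> d \<noteq> \<zero>\<^bsub>?K\<^esub>"
    using inj[of d \<zero>] d dR by auto
  have pow: "\<exists>q\<in>P. \<phi> d \<otimes>\<^bsub>?K\<^esub> t [^]\<^bsub>?K\<^esub> (n::nat) = \<phi> q" for n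
  proof (induction n)
    case 0
    then show ?case using d dR by auto
  next
    case (Suc n)
    then obtain q where q: "q \<in> P" "\<phi> d \<otimes>\<^bsub>?K\<^esub> t [^]\<^bsub>?K\<^esub> n = \<phi> q"
      by blast
    moreover have "\<phi> d \<otimes>\<^bsub>?K\<^esub> t [^]\<^bsub>?K\<^esub> Suc n = (\<phi> d \<otimes>\<^bsub>?K\<^esub> t [^]\<^bsub>?K\<^esub> n) \<otimes>\<^bsub>?K\<^esub> t"
      using dR t by (simp add: K.m_assoc)
    ultimately show ?case
      using step[OF q(1)] by simp
  qed
  define J where "J = (\<lambda>n. {r \<in> carrier R. \<exists>cs. length cs = n \<and> set cs \<subseteq> \<phi> ` carrier R \<and>
    \<phi> r = \<phi> d \<otimes>\<^bsub>?K\<^esub> K.eval cs t})"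
  have JI: "r \<in> J (length cs)"
    if "r \<in> carrier R" "set cs \<subseteq> \<phi> ` carrier R" "\<phi> r = \<phi> d \<otimes>\<^bsub>?K\<^esub> K.eval cs t" for r cs
    using that unfolding J_def by blast
  have JE: thesis if "r \<in> J n" "\<And>cs. \<lbrakk> r \<in> carrier R; length cs = n; set cs \<subseteq> \<phi> ` carrier R;
      set cs \<subseteq> carrier ?K; K.eval cs t \<in> carrier ?K; \<phi> r = \<phi> d \<otimes>\<^bsub>?K\<^esub> K.eval cs t \<rbrakk> \<Longrightarrow> thesis"
    for r n thesis
  proof -
    obtain cs where cs: "r \<in> carrier R" "length cs = n" "set cs \<subseteq> \<phi> ` carrier R"
        "\<phi> r = \<phi> d \<otimes>\<^bsub>?K\<^esub> K.eval cs t"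
      using \<open>r \<in> J n\<close> unfolding J_def by blast
    moreover have "set cs \<subseteq> carrier ?K"
      using cs(3) by auto
    ultimately show thesis
      using that(2)[of cs] K.eval_in_carrier[OF _ t] by blast
  qed
  have J_smult: "x \<otimes> r \<in> J n" if r: "r \<in> J n" and x: "x \<in> carrier R" for x r n
  proof -
    from r obtain cs where cs: "r \<in> carrier R" "length cs = n" "set cs \<subseteq> \<phi> ` carrier R"
        "set cs \<subseteq> carrier ?K" "K.eval cs t \<in> carrier ?K" "\<phi> r = \<phi> d \<otimes>\<^bsub>?K\<^esub> K.eval cs t"
      by (rule JE)
    let ?cs = "map ((\<otimes>\<^bsub>?K\<^esub>) (\<phi> x)) cs"
    have "\<phi> (x \<otimes> r) = \<phi> d \<otimes>\<^bsub>?K\<^esub> K.eval ?cs t"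
      using cs t x dR by (simp add: K.eval_map_mult K.m_ac)
    moreover have "set ?cs \<subseteq> \<phi> ` carrier R"
      using cs(3) x sub by (auto intro!: subringE(6))
    ultimately show ?thesis
      using JI[of "x \<otimes> r" ?cs] cs x by auto
  qed
  have J_add: "r \<oplus> s \<in> J n" if r: "r \<in> J n" and s: "s \<in> J n" for r s n
  proof -
    from r obtain cs where cs: "r \<in> carrier R" "length cs = n" "set cs \<subseteq> \<phi> ` carrier R"
        "set cs \<subseteq> carrier ?K" "K.eval cs t \<in> carrier ?K" "\<phi> r = \<phi> d \<otimes>\<^bsub>?K\<^esub> K.eval cs t"
      by (rule JE)
    from s obtain ds where ds: "s \<in> carrier R" "length ds = n" "set ds \<subseteq> \<phi> ` carrier R"
        "set ds \<subseteq> carrier ?K" "K.eval ds t \<in> carrier ?K" "\<phi> s = \<phi> d \<otimes>\<^bsub>?K\<^esub> K.eval ds t"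
      by (rule JE)
    let ?cs = "map2 (\<oplus>\<^bsub>?K\<^esub>) cs ds"
    have "\<phi> (r \<oplus> s) = \<phi> d \<otimes>\<^bsub>?K\<^esub> K.eval ?cs t"
      using cs ds t dR by (simp add: K.eval_map2_add K.r_distr)
    moreover have "set ?cs \<subseteq> \<phi> ` carrier R"
    proof
      fix z assume "z \<in> set ?cs"
      then obtain x y where xy: "(x, y) \<in> set (zip cs ds)" and z: "z = x \<oplus>\<^bsub>?K\<^esub> y"
        by auto
      have "x \<in> \<phi> ` carrier R" "y \<in> \<phi> ` carrier R"
        using set_zip_leftD[OF xy] set_zip_rightD[OF xy] cs(3) ds(3) by (simp_all add: subset_iff)
      then show "z \<in> \<phi> ` carrier R"
        unfolding z by (rule subringE(7)[OF sub])
    qed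
    ultimately show ?thesis
      using JI[of "r \<oplus> s" ?cs] cs ds by auto
  qed
  have J_zero: "\<zero> \<in> J n" for n
  proof -
    have "K.eval (replicate n \<zero>\<^bsub>?K\<^esub>) t = \<zero>\<^bsub>?K\<^esub>"
      using K.eval_replicate[of "[]" t n] t by simp
    moreover have "\<zero>\<^bsub>?K\<^esub> \<in> \<phi> ` carrier R"
      using sub by (rule subringE(2))
    ultimately show ?thesis
      using JI[of \<zero> "replicate n \<zero>\<^bsub>?K\<^esub>"] dR by (auto simp: set_replicate_conv_if split: if_splits)
  qed
  have J_ideal: "ideal (J n) R" for n
  proof (rule idealI[OF ring_axioms])
    show "subgroup (J n) (add_monoid R)"
    proof (rule add.subgroupI)
      show "J n \<subseteq> carrier R" by (auto simp: J_def)
      show "J n \<noteq> {}" using J_zero by blast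
      fix r s assume r: "r \<in> J n"
      then have "r \<in> carrier R" by (auto simp: J_def)
      then show "\<ominus> r \<in> J n"
        using J_smult[OF r, of "\<ominus> \<one>"] by (simp add: l_minus)
      assume "s \<in> J n"
      then show "r \<oplus> s \<in> J n" using r J_add by blast
    qed
    fix r x assume "r \<in> J n" "x \<in> carrier R"
    then show "x \<otimes> r \<in> J n" using J_smult by blast
    moreover have "r \<in> carrier R" using \<open>r \<in> J n\<close> by (auto simp: J_def)
    ultimately show "r \<otimes> x \<in> J n" using \<open>x \<in> carrier R\<close> by (simp add: m_comm)
  qed
  have J_Suc: "J n \<subseteq> J (Suc n)" for n
  proof
    fix r assume "r \<in> J n"
    then obtain cs where cs: "r \<in> carrier R" "length cs = n" "set cs \<subseteq> \<phi> ` carrier R"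
        "set cs \<subseteq> carrier ?K" "K.eval cs t \<in> carrier ?K" "\<phi> r = \<phi> d \<otimes>\<^bsub>?K\<^esub> K.eval cs t"
      by (rule JE)
    moreover have "\<zero>\<^bsub>?K\<^esub> \<in> \<phi> ` carrier R"
      using sub by (rule subringE(2))
    ultimately show "r \<in> J (Suc n)"
      \<comment> \<open>A leading zero lengthens the list without changing its value.\<close>
      using JI[of r "\<zero>\<^bsub>?K\<^esub> # cs"] t by simp
  qed
  then have J_mono: "J m \<subseteq> J n" if "m \<le> n" for m n
    using that by (rule lift_Suc_mono_le)
  have "\<Union>(range J) \<in> range J"
  proof (rule ideal_chain_is_trivial)
    show "subset.chain {I. ideal I R} (range J)"
      unfolding subset.chain_def using J_ideal J_mono nat_le_linear by blast
  qed simp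
  then obtain n where n: "\<And>m. J m \<subseteq> J n"
    by blast
  obtain q where q: "q \<in> P" "\<phi> d \<otimes>\<^bsub>?K\<^esub> t [^]\<^bsub>?K\<^esub> n = \<phi> q"
    using pow by blast
  \<comment> \<open>The list of a one followed by \<open>n\<close> zeros has length
    \<open>Suc n\<close> and evaluates to the \<open>n\<close>-th power of \<open>t\<close>. Since
    the chain is stable from \<open>n\<close> on, the same \<open>q\<close> also has a
    representation of length \<open>n\<close>.\<close>
  have "q \<in> J (Suc n)"
  proof -
    have "K.eval (replicate n \<zero>\<^bsub>?K\<^esub>) t = \<zero>\<^bsub>?K\<^esub>"
      using K.eval_replicate[of "[]" t n] t by simp
    then have "K.eval (\<one>\<^bsub>?K\<^esub> # replicate n \<zero>\<^bsub>?K\<^esub>) t = t [^]\<^bsub>?K\<^esub> n"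
      using t by simp
    moreover have "set (\<one>\<^bsub>?K\<^esub> # replicate n \<zero>\<^bsub>?K\<^esub>) \<subseteq> \<phi> ` carrier R"
      using subringE(2,3)[OF sub] by (auto simp: set_replicate_conv_if)
    ultimately show ?thesis
      using JI[of q "\<one>\<^bsub>?K\<^esub> # replicate n \<zero>\<^bsub>?K\<^esub>"] q P.Icarr by simp
  qed
  then have "q \<in> J n" using n by blast
  then obtain cs where cs: "length cs = n" "set cs \<subseteq> \<phi> ` carrier R"
      "K.eval cs t \<in> carrier ?K" "\<phi> q = \<phi> d \<otimes>\<^bsub>?K\<^esub> K.eval cs t"
    by (rule JE)
  \<comment> \<open>Cancelling \<open>d\<close> expresses the \<open>n\<close>-th power of
    \<open>t\<close> through lower powers.\<close>
  have "t [^]\<^bsub>?K\<^esub> length cs = K.eval cs t"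
    using K.m_lcancel[OF \<phi>d] q(2) cs dR t by simp
  then have "integral_over ?K (\<phi> ` carrier R) t"
    using K.integral_overI[OF sub cs(2) t] by simp
  then obtain r where r: "r \<in> carrier R" "t = \<phi> r"
    using integrally_closed t unfolding integrally_closed_def \<phi>_def by blast
  then have "\<phi> b = \<phi> (a \<otimes> r)"
    using at a by simp
  then show ?thesis
    using inj r a b by blast
qed

text \<open>The conclusion says \<open>P (a, b) = (a)\<close>. Here \<open>b\<close> is chosen so that the colon ideal
  \<open>Q b = ((a) : b)\<close> is maximal among those inside \<open>P\<close>; it is then prime, hence equal to \<open>P\<close>. As \<open>b / a\<close>
  is not integral, \<open>(b / a) P\<close> is an ideal not contained in \<open>P\<close>.\<close>

lemma (in dedekind_domain) prime_invertible:
  assumes "primeideal P R" "P \<noteq> {\<zero>}"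
  obtains a b p q where "a \<in> carrier R" "a \<noteq> \<zero>" "b \<in> carrier R" "p \<in> P" "q \<in> P"
    "a = a \<otimes> p \<oplus> b \<otimes> q" "\<And>x. x \<in> P \<Longrightarrow> \<exists>y\<in>carrier R. b \<otimes> x = a \<otimes> y"
proof -
  interpret P: primeideal P R by fact
  obtain a where a: "a \<in> P" "a \<noteq> \<zero>"
    using assms(2) P.zero_closed by blast
  have aR: "a \<in> carrier R"
    using a P.Icarr by blast
  define Q where "Q = (\<lambda>b. {x \<in> carrier R. \<exists>y\<in>carrier R. b \<otimes> x = a \<otimes> y})"
  have QI: "x \<in> Q b" if "x \<in> carrier R" "y \<in> carrier R" "b \<otimes> x = a \<otimes> y" for x y b
    using that unfolding Q_def by blast
  have QE: thesis if "x \<in> Q b" "\<And>y. \<lbrakk> x \<in> carrier R; y \<in> carrier R; b \<otimes> x = a \<otimes> y \<rbrakk> \<Longrightarrow> thesis"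
    for x b thesis
    using that unfolding Q_def by blast
  have Q_ideal: "ideal (Q b) R" if b: "b \<in> carrier R" for b
  proof (rule idealI[OF ring_axioms])
    have smult: "s \<otimes> x \<in> Q b" if "x \<in> Q b" "s \<in> carrier R" for x s
      using that(1)
    proof (rule QE)
      fix y assume y: "x \<in> carrier R" "y \<in> carrier R" "b \<otimes> x = a \<otimes> y"
      have "b \<otimes> (s \<otimes> x) = s \<otimes> (b \<otimes> x)"
        using y b that(2) m_lcomm by blast
      also have "\<dots> = a \<otimes> (s \<otimes> y)"
        using y aR that(2) by (simp add: m_ac)
      finally show ?thesis
        using y that(2) by (intro QI) auto
    qed
    show "subgroup (Q b) (add_monoid R)"
    proof (rule add.subgroupI)
      show "Q b \<subseteq> carrier R" by (auto simp: Q_def)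
      show "Q b \<noteq> {}" using QI[of \<zero> \<zero> b] b aR by auto
      fix x z assume x: "x \<in> Q b"
      then have "x \<in> carrier R" by (auto simp: Q_def)
      then show "\<ominus> x \<in> Q b"
        using smult[OF x, of "\<ominus> \<one>"] by (simp add: l_minus)
      assume z: "z \<in> Q b"
      from x obtain y where y: "x \<in> carrier R" "y \<in> carrier R" "b \<otimes> x = a \<otimes> y"
        by (rule QE)
      from z obtain w where w: "z \<in> carrier R" "w \<in> carrier R" "b \<otimes> z = a \<otimes> w"
        by (rule QE)
      show "x \<oplus> z \<in> Q b"
        using QI[of "x \<oplus> z" "y \<oplus> w" b] y w b aR by (simp add: r_distr)
    qed
    fix x s assume x: "x \<in> Q b" and s: "s \<in> carrier R"
    then show "s \<otimes> x \<in> Q b" using smult by blast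
    moreover have "x \<in> carrier R" using x by (auto simp: Q_def)
    ultimately show "x \<otimes> s \<in> Q b" using s by (simp add: m_comm)
  qed
  have Q_mult: "x \<in> Q (b \<otimes> s) \<longleftrightarrow> s \<otimes> x \<in> Q b"
    if "b \<in> carrier R" "s \<in> carrier R" "x \<in> carrier R" for b s x
    using that by (simp add: Q_def m_assoc)
  have Q_mult_sub: "Q b \<subseteq> Q (b \<otimes> s)" if "b \<in> carrier R" "s \<in> carrier R" for b s
  proof
    fix x assume x: "x \<in> Q b"
    then have "x \<in> carrier R" by (auto simp: Q_def)
    then show "x \<in> Q (b \<otimes> s)"
      using Q_mult that ideal.I_l_closed[OF Q_ideal x] by blast
  qed
  let ?C = "{Q b | b. b \<in> carrier R \<and> Q b \<subseteq> P}"
  \<comment> \<open>The colon ideal for \<open>b = \<one>\<close> is \<open>(a)\<close>, which lies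
    in \<open>P\<close> by the choice of \<open>a\<close>; so the family is nonempty.\<close>
  have "Q \<one> \<subseteq> P"
    using a P.I_r_closed by (auto simp: Q_def)
  then have "?C \<noteq> {}" by blast
  moreover have "\<And>J. J \<in> ?C \<Longrightarrow> ideal J R"
    using Q_ideal by blast
  ultimately obtain M where "M \<in> ?C" and max: "\<And>J. \<lbrakk> J \<in> ?C; M \<subseteq> J \<rbrakk> \<Longrightarrow> J = M"
    by (rule exists_maximal_in_family) blast+
  then obtain b where b: "b \<in> carrier R" "Q b \<subseteq> P" and M: "M = Q b"
    by blast
  have Q_eq: "Q (b \<otimes> s) = Q b" if s: "s \<in> carrier R" and sub: "Q (b \<otimes> s) \<subseteq> P" for s
  proof -
    have "Q (b \<otimes> s) \<in> ?C" using s sub b by blast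
    then show ?thesis using max Q_mult_sub s b unfolding M by blast
  qed
  \<comment> \<open>For \<open>s\<close> outside the prime \<open>P\<close>, the ideal
    \<open>Q (b \<otimes> s)\<close> stays inside \<open>P\<close>, so maximality gives
    \<open>Q (b \<otimes> s) = Q b\<close>.\<close>
  have cancel: "x \<in> Q b" if "s \<otimes> x \<in> Q b" "s \<in> carrier R" "s \<notin> P" "x \<in> carrier R" for s x
  proof -
    have "Q (b \<otimes> s) \<subseteq> P"
    proof
      fix r assume r: "r \<in> Q (b \<otimes> s)"
      then have "r \<in> carrier R" by (auto simp: Q_def)
      moreover from this have "s \<otimes> r \<in> P" using Q_mult b r that(2) by blast
      ultimately show "r \<in> P" using P.I_prime that by blast
    qed
    then have "Q (b \<otimes> s) = Q b"
      using Q_eq that by blast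
    then show ?thesis
      using Q_mult b that by blast
  qed
  have "primeideal (Q b) R"
  proof (rule primeidealI[OF Q_ideal[OF b(1)] cring_axioms])
    show "carrier R \<noteq> Q b"
      using b(2) P.I_notcarr P.a_subset by blast
    fix x y assume xy: "x \<in> carrier R" "y \<in> carrier R" "x \<otimes> y \<in> Q b"
    show "x \<in> Q b \<or> y \<in> Q b"
    \<comment> \<open>If \<open>Q (b \<otimes> x)\<close> stays in \<open>P\<close>, it equals
      \<open>Q b\<close> and contains \<open>y\<close>. Otherwise it has an element \<open>s\<close>
      outside \<open>P\<close>, and \<open>s\<close> can be cancelled from
      \<open>s \<otimes> x \<in> Q b\<close>.\<close>
    proof (cases "Q (b \<otimes> x) \<subseteq> P")
      case True
      then have "Q (b \<otimes> x) = Q b" using Q_eq xy by blast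
      then show ?thesis using Q_mult b xy by blast
    next
      case False
      then obtain s where s: "s \<in> Q (b \<otimes> x)" "s \<notin> P" by blast
      then have sR: "s \<in> carrier R" by (auto simp: Q_def)
      then have "s \<otimes> x \<in> Q b"
        using Q_mult[OF b(1) xy(1)] s(1) xy(1) by (simp add: m_comm)
      then show ?thesis using cancel s(2) sR xy(1) by blast
    qed
  qed
  moreover have "a \<in> Q b"
    using QI[of a b b] aR b m_comm by blast
  ultimately have "maximalideal (Q b) R"
    using nonzero_prime_maximal a(2) by blast
  then have QP: "Q b = P" and P_max: "maximalideal P R"
    using maximalideal.I_maximal[of "Q b" R P] P.is_ideal b(2) P.a_subset P.I_notcarr by auto
  \<comment> \<open>This says that \<open>b / a\<close> is not in \<open>R\<close>, so by integral
    closedness it cannot map \<open>P\<close> into itself.\<close>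
  have "\<one> \<notin> Q b"
    using P.one_imp_carrier P.I_notcarr unfolding QP by blast
  then have "\<nexists>r. r \<in> carrier R \<and> b = a \<otimes> r"
    using QI[of \<one> _ b] b(1) by auto
  then have "\<exists>p\<in>P. \<forall>q\<in>P. b \<otimes> p \<noteq> a \<otimes> q"
    using multiplier_of_ideal_integral[OF P.is_ideal assms(2) aR a(2) b(1)] by blast
  then obtain p where p: "p \<in> P" "\<And>q. q \<in> P \<Longrightarrow> b \<otimes> p \<noteq> a \<otimes> q"
    by blast
  have "p \<in> Q b" using p(1) QP by simp
  then obtain e where e: "p \<in> carrier R" "e \<in> carrier R" "b \<otimes> p = a \<otimes> e"
    by (rule QE)
  \<comment> \<open>Here \<open>e\<close> is \<open>(b / a) p\<close>, and it is invertible modulo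
    \<open>P\<close>. Multiplying \<open>\<one> = p' \<oplus> r \<otimes> e\<close> by
    \<open>a\<close> and replacing \<open>a \<otimes> e\<close> by \<open>b \<otimes> p\<close>
    yields the claimed relation.\<close>
  then have "e \<notin> P" using p(2) by blast
  then obtain p' r where r: "p' \<in> P" "r \<in> carrier R" "\<one> = p' \<oplus> r \<otimes> e"
    using maximalideal_inverse[OF P_max e(2)] by blast
  have p': "p' \<in> carrier R" using r P.Icarr by blast
  have "a = a \<otimes> (p' \<oplus> r \<otimes> e)"
    using aR by (simp flip: r(3))
  also have "\<dots> = a \<otimes> p' \<oplus> r \<otimes> (a \<otimes> e)"
    using aR p' r e by (simp add: r_distr m_ac)
  also have "r \<otimes> (a \<otimes> e) = b \<otimes> (r \<otimes> p)"
    using b e r by (simp add: m_ac flip: e(3))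
  finally have "a = a \<otimes> p' \<oplus> b \<otimes> (r \<otimes> p)" .
  moreover have "r \<otimes> p \<in> P" using p r P.I_l_closed by blast
  moreover have "\<exists>y\<in>carrier R. b \<otimes> x = a \<otimes> y" if "x \<in> P" for x
    using that unfolding QP[symmetric] Q_def by blast
  ultimately show thesis
    using that[of a b p' "r \<otimes> p"] aR a(2) b(1) r(1) by blast
qed

text \<open>A product of ideals lies in each factor. Conversely, invertibility of \<open>P\<close>
  allows \<open>I\<close> to be divided by \<open>P\<close>, and the containment keeps the quotient
  inside \<open>R\<close>.\<close>

lemma (in dedekind_domain) prime_divides_iff_contains:
  assumes P: "primeideal P R" and I: "ideal I R" "I \<noteq> {\<zero>}"
  shows "P divides\<^bsub>ideals_set R\<^esub> I \<longleftrightarrow> I \<subseteq> P"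
proof
  interpret P: primeideal P R by fact
  assume "P divides\<^bsub>ideals_set R\<^esub> I"
  then obtain J where "ideal J R" "I = P \<cdot> J"
    unfolding factor_def ideals_set_def by auto
  then show "I \<subseteq> P"
    using ideal_prod_inter P.is_ideal by blast
next
  interpret P: primeideal P R by fact
  interpret I: ideal I R by fact
  assume sub: "I \<subseteq> P"
  have "P \<noteq> {\<zero>}"
    using sub I(2) I.zero_closed by blast
  then obtain a b p q where a: "a \<in> carrier R" "a \<noteq> \<zero>" and b: "b \<in> carrier R"
    and pq: "p \<in> P" "q \<in> P" "a = a \<otimes> p \<oplus> b \<otimes> q"
    and ba: "\<And>x. x \<in> P \<Longrightarrow> \<exists>y\<in>carrier R. b \<otimes> x = a \<otimes> y"
    using prime_invertible[OF P] by blast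
  have pqR: "p \<in> carrier R" "q \<in> carrier R"
    using pq P.Icarr by auto
  txt \<open>The cofactor is \<open>P\<^sup>-\<^sup>1 I = a\<^sup>-\<^sup>1 (a, b) I\<close>.\<close>
  define J where "J = {c \<in> carrier R. \<exists>i\<in>I. \<exists>j\<in>I. a \<otimes> c = a \<otimes> i \<oplus> b \<otimes> j}"
  have JE: thesis if "c \<in> J" "\<And>i j. \<lbrakk> c \<in> carrier R; i \<in> I; j \<in> I; i \<in> carrier R; j \<in> carrier R;
      a \<otimes> c = a \<otimes> i \<oplus> b \<otimes> j \<rbrakk> \<Longrightarrow> thesis" for c thesis
    using that I.Icarr unfolding J_def by blast
  have JI: "c \<in> J" if "c \<in> carrier R" "i \<in> I" "j \<in> I" "a \<otimes> c = a \<otimes> i \<oplus> b \<otimes> j" for c i j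
    using that unfolding J_def by blast
  have J: "ideal J R"
  proof (rule idealI[OF ring_axioms])
    have smult: "s \<otimes> c \<in> J" if "c \<in> J" "s \<in> carrier R" for c s
      using that(1)
    proof (rule JE)
      fix i j assume c: "c \<in> carrier R" "i \<in> I" "j \<in> I" "i \<in> carrier R" "j \<in> carrier R"
        "a \<otimes> c = a \<otimes> i \<oplus> b \<otimes> j"
      have "a \<otimes> (s \<otimes> c) = s \<otimes> (a \<otimes> c)"
        using c a that(2) m_lcomm by blast
      also have "\<dots> = a \<otimes> (s \<otimes> i) \<oplus> b \<otimes> (s \<otimes> j)"
        using c a b that(2) by (simp add: r_distr m_ac)
      finally show ?thesis
        using c that(2) I.I_l_closed by (intro JI) auto
    qed
    show "subgroup J (add_monoid R)"
    proof (rule add.subgroupI)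
      show "J \<subseteq> carrier R" by (auto simp: J_def)
      show "J \<noteq> {}" using JI[of \<zero> \<zero> \<zero>] a b I.zero_closed by auto
      fix c d assume c: "c \<in> J"
      then have "c \<in> carrier R" by (auto simp: J_def)
      then show "\<ominus> c \<in> J"
        using smult[OF c, of "\<ominus> \<one>"] by (simp add: l_minus)
      assume d: "d \<in> J"
      from c obtain i j where ij: "c \<in> carrier R" "i \<in> I" "j \<in> I" "i \<in> carrier R" "j \<in> carrier R"
        "a \<otimes> c = a \<otimes> i \<oplus> b \<otimes> j" by (rule JE)
      from d obtain k l where kl: "d \<in> carrier R" "k \<in> I" "l \<in> I" "k \<in> carrier R" "l \<in> carrier R"
        "a \<otimes> d = a \<otimes> k \<oplus> b \<otimes> l" by (rule JE)
      have "a \<otimes> (c \<oplus> d) = a \<otimes> (i \<oplus> k) \<oplus> b \<otimes> (j \<oplus> l)"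
        using ij kl a b by (simp add: r_distr a_ac)
      then show "c \<oplus> d \<in> J"
        using ij kl I.a_closed by (intro JI) auto
    qed
    fix c s assume c: "c \<in> J" and s: "s \<in> carrier R"
    then show "s \<otimes> c \<in> J" using smult by blast
    moreover have "c \<in> carrier R" using c by (auto simp: J_def)
    ultimately show "c \<otimes> s \<in> J" using s by (simp add: m_comm)
  qed
  have "P \<cdot> J \<subseteq> I"
  proof
    fix z assume "z \<in> P \<cdot> J"
    then show "z \<in> I"
    proof (induction z rule: ideal_prod.induct)
      case (prod x c)
      have xR: "x \<in> carrier R" using prod P.Icarr by blast
      from prod(2) obtain i j where ij: "c \<in> carrier R" "i \<in> I" "j \<in> I"
        "i \<in> carrier R" "j \<in> carrier R" "a \<otimes> c = a \<otimes> i \<oplus> b \<otimes> j" by (rule JE)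
      obtain y where y: "y \<in> carrier R" "b \<otimes> x = a \<otimes> y"
        using ba prod(1) by blast
      \<comment> \<open>With \<open>y = (b / a) x\<close> in \<open>R\<close>, multiplying
        \<open>c = i + (b / a) j\<close> by \<open>x\<close> clears the denominator.\<close>
      have "a \<otimes> (x \<otimes> c) = x \<otimes> (a \<otimes> c)"
        using a xR ij m_lcomm by blast
      also have "\<dots> = a \<otimes> (x \<otimes> i) \<oplus> (b \<otimes> x) \<otimes> j"
        using a b xR ij by (simp add: r_distr m_ac)
      also have "\<dots> = a \<otimes> (x \<otimes> i \<oplus> y \<otimes> j)"
        using a b xR ij y by (simp add: r_distr m_assoc)
      finally have "x \<otimes> c = x \<otimes> i \<oplus> y \<otimes> j"
        using m_lcancel[OF a(2,1)] xR ij y by simp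
      then show ?case
        using I.I_l_closed ij xR y by simp
    qed (rule I.a_closed)
  qed
  moreover have "I \<subseteq> P \<cdot> J"
  proof
    fix x assume x: "x \<in> I"
    then have xR: "x \<in> carrier R" using I.Icarr by blast
    have "x \<in> P" using x sub by blast
    then obtain y where y: "y \<in> carrier R" "b \<otimes> x = a \<otimes> y"
      using ba by blast
    have "x \<in> J"
      using JI[of x x \<zero>] a b x xR I.zero_closed by simp
    moreover have "y \<in> J"
      using JI[of y \<zero> x] a b x xR y I.zero_closed by simp
    \<comment> \<open>This is \<open>\<one> = p + (b / a) q\<close> multiplied by
      \<open>a x\<close>, where \<open>y = (b / a) x\<close>; both \<open>x\<close> and
      \<open>y\<close> lie in the cofactor \<open>J\<close>.\<close>
    moreover have "a \<otimes> x = a \<otimes> (p \<otimes> x \<oplus> q \<otimes> y)"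
    proof -
      have "a \<otimes> x = (a \<otimes> p \<oplus> b \<otimes> q) \<otimes> x"
        using pq(3) by simp
      also have "\<dots> = a \<otimes> (p \<otimes> x) \<oplus> q \<otimes> (b \<otimes> x)"
        using a b pqR xR by (simp add: l_distr r_distr m_ac)
      also have "\<dots> = a \<otimes> (p \<otimes> x \<oplus> q \<otimes> y)"
        using a pqR xR y by (simp add: r_distr m_ac)
      finally show ?thesis .
    qed
    then have "x = p \<otimes> x \<oplus> q \<otimes> y"
      using m_lcancel[OF a(2,1)] xR pqR y by simp
    ultimately show "x \<in> P \<cdot> J"
      using pq ideal_prod.prod ideal_prod.sum by metis
  qed
  ultimately have "I = P \<cdot> J" by blast
  then show "P divides\<^bsub>ideals_set R\<^esub> I"
    using J unfolding factor_def ideals_set_def by auto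
qed

section \<open>Units of quotient rings\<close>

lemma (in ring) carrier_quot: "carrier (R Quot I) = ((+>) I) ` carrier R"
  by (auto simp: FactRing_def A_RCOSETS_def')

lemma (in ring) ideal_minus_closed:
  assumes "ideal I R" "x \<in> I" "y \<in> I"
  shows "x \<ominus> y \<in> I"
  using assms by (simp add: a_minus_def additive_subgroup.a_closed additive_subgroup.a_inv_closed
      ideal.axioms(1))

lemma (in ring) ideal_minus_mem_iff:
  assumes "ideal I R" "x \<in> carrier R" "y \<in> carrier R" "x \<ominus> y \<in> I"
  shows "x \<in> I \<longleftrightarrow> y \<in> I"
proof -
  have "y = x \<ominus> (x \<ominus> y)" "x = (x \<ominus> y) \<oplus> y"
    using assms(2,3) by algebra+
  then show ?thesis
    using ideal_minus_closed[OF assms(1)] assms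
    by (metis additive_subgroup.a_closed ideal.axioms(1))
qed

lemma (in ring) rcos_minus:
  assumes "ideal I R" "x \<in> carrier R" "y \<in> carrier R"
  shows "(I +> x) \<ominus>\<^bsub>R Quot I\<^esub> (I +> y) = I +> (x \<ominus> y)"
proof -
  interpret h: ring_hom_ring R "R Quot I" "(+>) I"
    by (rule ideal.rcos_ring_hom_ring[OF assms(1)])
  show ?thesis
    using assms by (simp add: a_minus_def)
qed

text \<open>An inverse \<open>y\<close> puts \<open>x y - 1\<close> into \<open>I\<close>, so a
  prime above \<open>I\<close> containing \<open>x\<close> would contain \<open>\<one>\<close>. If
  no prime above \<open>I\<close> contains \<open>x\<close>, then \<open>I + (x)\<close> lies in no
  maximal ideal, and writing \<open>\<one>\<close> in it gives an inverse.\<close>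

lemma (in noetherian_domain) quot_unit_iff:
  assumes I: "ideal I R" and x: "x \<in> carrier R"
  shows "I +> x \<in> Units (R Quot I) \<longleftrightarrow> (\<forall>P. primeideal P R \<and> I \<subseteq> P \<longrightarrow> x \<notin> P)"
proof -
  interpret I: ideal I R by fact
  interpret Q: cring "R Quot I" by (rule I.quotient_is_cring[OF cring_axioms])
  interpret h: ring_hom_ring R "R Quot I" "(+>) I" by (rule I.rcos_ring_hom_ring)
  show ?thesis
  proof (intro iffI allI impI)
    fix P assume unit: "I +> x \<in> Units (R Quot I)" and P: "primeideal P R \<and> I \<subseteq> P"
    interpret P: primeideal P R using P by blast
    obtain Y where Y: "Y \<in> carrier (R Quot I)" "(I +> x) \<otimes>\<^bsub>R Quot I\<^esub> Y = \<one>\<^bsub>R Quot I\<^esub>"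
      using unit Q.Units_r_inv_ex by blast
    obtain y where y: "y \<in> carrier R" "Y = I +> y"
      using Y(1) unfolding carrier_quot by blast
    have "I +> (x \<otimes> y) = I +> \<one>"
      using x y Y(2) by simp
    then have "x \<otimes> y \<ominus> \<one> \<in> P"
      using quotient_eq_iff_same_a_r_cos[OF I, of "x \<otimes> y" \<one>] x y P by auto
    then have "x \<otimes> y \<notin> P"
      using ideal_minus_mem_iff[OF P.is_ideal, of "x \<otimes> y" \<one>] x y
        P.one_imp_carrier P.I_notcarr by auto
    then show "x \<notin> P"
      using P.I_r_closed y(1) by blast
  next
    assume *: "\<forall>P. primeideal P R \<and> I \<subseteq> P \<longrightarrow> x \<notin> P"
    let ?J = "I <+>\<^bsub>R\<^esub> PIdl x"
    note J = ideal_add_cgenideal[OF I x]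
    have "?J = carrier R"
    proof (rule ccontr)
      assume "?J \<noteq> carrier R"
      then obtain M where "maximalideal M R" "?J \<subseteq> M"
        using exists_maximalideal[OF J(1)] by blast
      then show False
        using * maximalideal_prime J(2,3) by blast
    qed
    then have "\<one> \<in> ?J" by simp
    then obtain i r where ir: "i \<in> I" "r \<in> carrier R" "\<one> = i \<oplus> r \<otimes> x"
      unfolding mem_add_cgenideal by blast
    have iR: "i \<in> carrier R" using ir I.Icarr by blast
    have "\<one> \<ominus> r \<otimes> x = i"
      unfolding ir(3) using iR ir(2) x by algebra
    then have "I +> \<one> = I +> (r \<otimes> x)"
      using quotient_eq_iff_same_a_r_cos[OF I, of \<one> "r \<otimes> x"] ir x by auto
    then have "(I +> r) \<otimes>\<^bsub>R Quot I\<^esub> (I +> x) = \<one>\<^bsub>R Quot I\<^esub>"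
      using ir(2) x by simp
    moreover from this have "(I +> x) \<otimes>\<^bsub>R Quot I\<^esub> (I +> r) = \<one>\<^bsub>R Quot I\<^esub>"
      using Q.m_comm[of "I +> r" "I +> x"] ir(2) x by simp
    ultimately show "I +> x \<in> Units (R Quot I)"
      using ir(2) x h.hom_closed unfolding Units_def by blast
  qed
qed

section \<open>Sizes of quotients and finiteness above an ideal\<close>

text \<open>The cosets of \<open>\<zero>\<close> and \<open>\<one>\<close> differ because
  \<open>P\<close> is proper; size two means that there is no third coset. The bound assumes
  finiteness since \<open>card\<close> of an infinite set is zero.\<close>

lemma (in ring) card_quot_eq_2_iff:
  assumes P: "ideal P R" "P \<noteq> carrier R"
  shows "card (carrier (R Quot P)) = 2 \<longleftrightarrow> (\<forall>x\<in>carrier R. x \<in> P \<or> x \<ominus> \<one> \<in> P)"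
    and "finite (carrier (R Quot P)) \<Longrightarrow> 2 \<le> card (carrier (R Quot P))"
proof -
  interpret P: ideal P R by fact
  have mem: "P +> x = P +> \<zero> \<longleftrightarrow> x \<in> P" "P +> x = P +> \<one> \<longleftrightarrow> x \<ominus> \<one> \<in> P"
    if "x \<in> carrier R" for x
    using quotient_eq_iff_same_a_r_cos[OF P(1) that zero_closed]
      quotient_eq_iff_same_a_r_cos[OF P(1) that one_closed] that by (simp_all add: a_minus_def)
  have ne: "P +> \<zero> \<noteq> P +> \<one>"
    using mem(1)[of \<one>] P.one_imp_carrier P(2) by auto
  then have c2: "card {P +> \<zero>, P +> \<one>} = 2" by simp
  have sub: "{P +> \<zero>, P +> \<one>} \<subseteq> carrier (R Quot P)"
    unfolding carrier_quot by blast
  show "2 \<le> card (carrier (R Quot P))" if "finite (carrier (R Quot P))"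
    using card_mono[OF that sub] c2 by simp
  have "card (carrier (R Quot P)) = 2 \<longleftrightarrow> carrier (R Quot P) = {P +> \<zero>, P +> \<one>}"
  proof
    assume card: "card (carrier (R Quot P)) = 2"
    then have "finite (carrier (R Quot P))"
      by (intro card_ge_0_finite) simp
    then show "carrier (R Quot P) = {P +> \<zero>, P +> \<one>}"
      using card_subset_eq[OF _ sub] c2 card by simp
  qed (use c2 in simp)
  also have "\<dots> \<longleftrightarrow> (\<forall>x\<in>carrier R. P +> x = P +> \<zero> \<or> P +> x = P +> \<one>)"
    unfolding carrier_quot by auto
  also have "\<dots> \<longleftrightarrow> (\<forall>x\<in>carrier R. x \<in> P \<or> x \<ominus> \<one> \<in> P)"
    using mem by blast
  finally show "card (carrier (R Quot P)) = 2 \<longleftrightarrow> (\<forall>x\<in>carrier R. x \<in> P \<or> x \<ominus> \<one> \<in> P)" .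
qed

lemma (in ring) finite_quot_mono:
  assumes I: "ideal I R" and P: "ideal P R" and sub: "I \<subseteq> P"
    and fin: "finite (carrier (R Quot I))"
  shows "finite (carrier (R Quot P))"
proof -
  \<comment> \<open>The natural surjection from \<open>R / I\<close> onto \<open>R / P\<close>,
    computed on chosen representatives.\<close>
  let ?g = "\<lambda>C. P +> inv_into (carrier R) ((+>) I) C"
  have "P +> x = ?g (I +> x)" if x: "x \<in> carrier R" for x
  proof -
    let ?y = "inv_into (carrier R) ((+>) I) (I +> x)"
    have mem: "I +> x \<in> ((+>) I) ` carrier R"
      using x by (rule imageI)
    have "?y \<in> carrier R" "I +> ?y = I +> x"
      using inv_into_into[OF mem] f_inv_into_f[OF mem] .
    then show ?thesis
      using quotient_eq_iff_same_a_r_cos[OF I, of x ?y]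
        quotient_eq_iff_same_a_r_cos[OF P, of x ?y] x sub by auto
  qed
  then have "carrier (R Quot P) \<subseteq> ?g ` carrier (R Quot I)"
    unfolding carrier_quot by blast
  then show ?thesis
    using fin finite_surj by blast
qed

text \<open>An ideal containing \<open>I\<close> is determined by its image in \<open>R / I\<close>,
  and a finite set has finitely many subsets.\<close>

lemma (in ring) finite_ideals_above:
  assumes I: "ideal I R" and fin: "finite (carrier (R Quot I))"
  shows "finite {P. ideal P R \<and> I \<subseteq> P}"
proof (rule inj_on_finite)
  let ?f = "\<lambda>P. ((+>) I) ` P"
  have sub: "P \<subseteq> P'"
    if P: "ideal P R" and P': "ideal P' R" "I \<subseteq> P'" and eq: "?f P = ?f P'" for P P'
  proof
    fix x assume x: "x \<in> P"
    have xR: "x \<in> carrier R" using ideal.Icarr[OF P x] .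
    have "I +> x \<in> ?f P'" using x by (simp flip: eq)
    then obtain y where y: "y \<in> P'" "I +> x = I +> y" by blast
    have yR: "y \<in> carrier R" using ideal.Icarr[OF P'(1) y(1)] .
    have "x \<ominus> y \<in> P'"
      using quotient_eq_iff_same_a_r_cos[OF I xR yR] y(2) P'(2) by blast
    then show "x \<in> P'"
      using ideal_minus_mem_iff[OF P'(1) xR yR] y(1) by blast
  qed
  show "inj_on ?f {P. ideal P R \<and> I \<subseteq> P}"
  proof (rule inj_onI)
    fix P P' assume "P \<in> {P. ideal P R \<and> I \<subseteq> P}" "P' \<in> {P. ideal P R \<and> I \<subseteq> P}" and eq: "?f P = ?f P'"
    then show "P = P'"
      using sub[of P P'] sub[of P' P] by simp
  qed
  show "?f ` {P. ideal P R \<and> I \<subseteq> P} \<subseteq> Pow (carrier (R Quot I))"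
    unfolding carrier_quot by (auto dest: ideal.Icarr)
  show "finite (Pow (carrier (R Quot I)))"
    using fin by simp
qed

section \<open>Chinese remaindering for maximal ideals\<close>

text \<open>Take from each ideal an element outside \<open>M\<close>; their product lies in every
  ideal, and outside \<open>M\<close> because \<open>M\<close> is prime.\<close>

lemma (in cring) prime_avoids_finite_inter:
  assumes "finite F" and M: "primeideal M R"
    and "\<forall>P\<in>F. ideal P R" "\<forall>P\<in>F. \<not> P \<subseteq> M"
  shows "\<exists>e\<in>carrier R. e \<notin> M \<and> (\<forall>P\<in>F. e \<in> P)"
  using assms(1,3,4)
proof (induction F rule: finite_induct)
  interpret M: primeideal M R by fact
  case empty
  then show ?case
    using M.one_imp_carrier M.I_notcarr by auto
next
  interpret M: primeideal M R by fact
  case (insert P F)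
  then have "\<exists>e\<in>carrier R. e \<notin> M \<and> (\<forall>P\<in>F. e \<in> P)"
    by simp
  then obtain e where e: "e \<in> carrier R" "e \<notin> M" "\<forall>P\<in>F. e \<in> P"
    by blast
  have P: "ideal P R" "\<not> P \<subseteq> M"
    using insert.prems by simp_all
  then obtain f where f: "f \<in> P" "f \<notin> M"
    by blast
  have fR: "f \<in> carrier R"
    using ideal.Icarr[OF P(1) f(1)] .
  have "e \<otimes> f \<notin> M"
    using M.I_prime[OF e(1) fR] e(2) f(2) by blast
  moreover have "e \<otimes> f \<in> P"
    using ideal.I_l_closed[OF P(1) f(1) e(1)] .
  moreover have "e \<otimes> f \<in> P'" if "P' \<in> F" for P'
    using insert.prems(1) e(3) that fR by (intro ideal.I_r_closed) simp_all
  ultimately show ?case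
    using e(1) fR by (intro bexI[of _ "e \<otimes> f"]) auto
qed

text \<open>Induction on \<open>F\<close>: a solution for the earlier ideals is corrected at the new
  ideal \<open>M\<close> by a multiple of an element \<open>e\<close> that lies in all earlier
  ideals but not in \<open>M\<close>.\<close>

lemma (in cring) chinese_remainder_maximalideals:
  assumes "finite F" "\<forall>P\<in>F. maximalideal P R" "\<forall>P\<in>F. c P \<in> carrier R"
  shows "\<exists>u\<in>carrier R. \<forall>P\<in>F. u \<ominus> c P \<in> P"
  using assms
proof (induction F rule: finite_induct)
  case empty
  then show ?case by blast
next
  case (insert M F)
  then have "\<exists>u\<in>carrier R. \<forall>P\<in>F. u \<ominus> c P \<in> P"
    by simp
  then obtain u where u: "u \<in> carrier R" "\<forall>P\<in>F. u \<ominus> c P \<in> P"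
    by blast
  have max: "maximalideal P R" if "P \<in> insert M F" for P
    using bspec[OF insert.prems(1) that] .
  have c: "c P \<in> carrier R" if "P \<in> insert M F" for P
    using bspec[OF insert.prems(2) that] .
  interpret M: maximalideal M R by (rule max) simp
  have "\<exists>e\<in>carrier R. e \<notin> M \<and> (\<forall>P\<in>F. e \<in> P)"
  proof (rule prime_avoids_finite_inter[OF insert.hyps(1)])
    show "primeideal M R" using maximalideal_prime[OF M.is_maximalideal] .
    show "\<forall>P\<in>F. ideal P R"
      by (intro ballI maximalideal.axioms(1) max) simp
    show "\<forall>P\<in>F. \<not> P \<subseteq> M"
    proof (intro ballI notI)
      fix P assume P: "P \<in> F" "P \<subseteq> M"
      then have "maximalideal P R" using max by simp
      from maximalideal.I_maximal[OF this M.is_ideal P(2) M.a_subset]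
      show False using M.I_notcarr P(1) insert.hyps(2) by auto
    qed
  qed
  then obtain e where e: "e \<in> carrier R" "e \<notin> M" "\<forall>P\<in>F. e \<in> P"
    by blast
  obtain p r where p: "p \<in> M" "r \<in> carrier R" "\<one> = p \<oplus> r \<otimes> e"
    using maximalideal_inverse[OF M.is_maximalideal e(1,2)] by blast
  have R: "p \<in> carrier R" "c M \<in> carrier R"
    using p(1) M.Icarr c by simp_all
  \<comment> \<open>The error of \<open>u\<close> at \<open>M\<close>. As
    \<open>r \<otimes> e\<close> is 1 modulo \<open>M\<close>, adding
    \<open>w \<otimes> r \<otimes> e\<close> removes it, and \<open>e\<close> keeps the other
    residues unchanged.\<close>
  define w where "w = c M \<ominus> u"
  have w: "w \<in> carrier R" using R u by (simp add: w_def)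
  let ?v = "u \<oplus> w \<otimes> r \<otimes> e"
  have v: "?v \<in> carrier R" using u w p e by simp
  have "w = w \<otimes> (p \<oplus> r \<otimes> e)" using w by (simp flip: p(3))
  also have "\<dots> = w \<otimes> p \<oplus> w \<otimes> r \<otimes> e" using w R(1) p(2) e(1) by algebra
  finally have w_eq: "w \<otimes> p \<oplus> w \<otimes> r \<otimes> e = w" ..
  have "w \<otimes> r \<otimes> e = (w \<otimes> p \<oplus> w \<otimes> r \<otimes> e) \<ominus> w \<otimes> p"
    using w R(1) p(2) e(1) by algebra
  then have "?v \<ominus> c M = u \<oplus> (w \<ominus> w \<otimes> p) \<ominus> c M"
    unfolding w_eq by (rule arg_cong)
  also have "\<dots> = \<ominus> w \<otimes> p"
    unfolding w_def using R u(1) by algebra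
  finally have "?v \<ominus> c M = \<ominus> w \<otimes> p" .
  then have "?v \<ominus> c M \<in> M"
    using M.I_l_closed[OF p(1)] w by simp
  moreover have "?v \<ominus> c P \<in> P" if P: "P \<in> F" for P
  proof -
    have maxP: "maximalideal P R" and cP: "c P \<in> carrier R"
      using max c P by simp_all
    interpret P: maximalideal P R by (rule maxP)
    have "?v \<ominus> c P = (u \<ominus> c P) \<oplus> w \<otimes> r \<otimes> e"
      using cP u(1) w p(2) e(1) by algebra
    moreover have "w \<otimes> r \<otimes> e \<in> P"
      using P.I_l_closed[of e "w \<otimes> r"] e(3) P w p(2) by simp
    ultimately show ?thesis
      using P.a_closed u(2) P by simp
  qed
  ultimately have "\<forall>P\<in>insert M F. ?v \<ominus> c P \<in> P"
    by simp
  then show ?case using v by (rule bexI)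
qed

section \<open>Bipartite unitary Cayley graphs\<close>

text \<open>Existence of a suitable prime above \<open>I\<close> is the form that the colouring and
  the triangle use; the passage to divisibility and to the minimum is left to the theorem.\<close>

lemma (in dedekind_domain) bipartite_quot_iff:
  assumes I: "ideal I R" "I \<noteq> {\<zero>}" and fin: "finite (carrier (R Quot I))"
  shows "bipartite (with_proj (unitary_cayley_graph (R Quot I))) \<longleftrightarrow>
    (\<exists>P. primeideal P R \<and> I \<subseteq> P \<and> card (carrier (R Quot P)) = 2)"
    (is "bipartite (with_proj ?G) \<longleftrightarrow> _")
proof
  assume "bipartite (with_proj ?G)"
  then obtain U V where disj: "U \<inter> V = {}" and arcs: "\<forall>e\<in>arcs (with_proj ?G).
      tail (with_proj ?G) e \<in> U \<and> head (with_proj ?G) e \<in> V \<or>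
      tail (with_proj ?G) e \<in> V \<and> head (with_proj ?G) e \<in> U"
    unfolding bipartite_def by blast
  have edge: "A \<in> U \<and> B \<in> V \<or> A \<in> V \<and> B \<in> U" if "(A, B) \<in> parcs ?G" for A B
    using bspec[OF arcs, of "(A, B)"] that by simp
  show "\<exists>P. primeideal P R \<and> I \<subseteq> P \<and> card (carrier (R Quot P)) = 2"
  proof (rule ccontr)
    assume neg: "\<not> ?thesis"
    let ?F = "{P. primeideal P R \<and> I \<subseteq> P}"
    have finF: "finite ?F"
      by (rule finite_subset[OF _ finite_ideals_above[OF I(1) fin]]) (auto dest: primeideal.axioms(1))
    \<comment> \<open>Primes above the nonzero ideal \<open>I\<close> are nonzero, hence maximal, as
      Chinese remaindering requires.\<close>
    have max: "maximalideal P R" if P: "P \<in> ?F" for P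
    proof (rule nonzero_prime_maximal)
      show "primeideal P R" using P by simp
      show "P \<noteq> {\<zero>}"
        using P I(2) additive_subgroup.zero_closed[OF ideal.axioms(1)[OF I(1)]] by blast
    qed
    have "\<exists>x\<in>carrier R. x \<notin> P \<and> x \<ominus> \<one> \<notin> P" if P: "P \<in> ?F" for P
    proof -
      interpret P: primeideal P R using P by simp
      show ?thesis
        using neg P card_quot_eq_2_iff(1)[OF P.is_ideal P.I_notcarr[symmetric]] by blast
    qed
    then obtain c where c: "\<And>P. P \<in> ?F \<Longrightarrow> c P \<in> carrier R \<and> c P \<notin> P \<and> c P \<ominus> \<one> \<notin> P"
      by metis
    have "\<exists>u\<in>carrier R. \<forall>P\<in>?F. u \<ominus> c P \<in> P"
      by (rule chinese_remainder_maximalideals[OF finF]) (use max c in simp_all)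
    then obtain u where u: "u \<in> carrier R" "\<And>P. P \<in> ?F \<Longrightarrow> u \<ominus> c P \<in> P"
      by blast
    \<comment> \<open>Modulo each \<open>P\<close> the element \<open>u\<close> agrees with
      \<open>c P\<close>, whose residue is neither 0 nor 1.\<close>
    have "u \<notin> P \<and> u \<ominus> \<one> \<notin> P \<and> \<one> \<notin> P" if P: "P \<in> ?F" for P
    proof -
      interpret P: primeideal P R using P by simp
      have cP: "c P \<in> carrier R" "c P \<notin> P" "c P \<ominus> \<one> \<notin> P"
        using c[OF P] by simp_all
      have "(u \<ominus> \<one>) \<ominus> (c P \<ominus> \<one>) = u \<ominus> c P"
        using u(1) cP(1) by algebra
      then show ?thesis
        using ideal_minus_mem_iff[OF P.is_ideal, of u "c P"]
          ideal_minus_mem_iff[OF P.is_ideal, of "u \<ominus> \<one>" "c P \<ominus> \<one>"]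
          u(1) u(2)[OF P] cP P.one_imp_carrier P.I_notcarr by auto
    qed
    then have "I +> u \<in> Units (R Quot I)" "I +> (u \<ominus> \<one>) \<in> Units (R Quot I)"
      "I +> \<one> \<in> Units (R Quot I)"
      using u(1) quot_unit_iff[OF I(1)] by auto
    moreover have "u \<ominus> \<zero> = u" "\<one> \<ominus> \<zero> = \<one>"
      using u(1) by algebra+
    ultimately have "(I +> u, I +> \<zero>) \<in> parcs ?G" "(I +> u, I +> \<one>) \<in> parcs ?G"
      "(I +> \<one>, I +> \<zero>) \<in> parcs ?G"
      using u(1) by (simp_all add: unitary_cayley_graph_def rcos_minus[OF I(1)] carrier_quot)
    then show False
      using edge disj by blast
  qed
next
  assume "\<exists>P. primeideal P R \<and> I \<subseteq> P \<and> card (carrier (R Quot P)) = 2"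
  then obtain P where P: "primeideal P R" "I \<subseteq> P" "card (carrier (R Quot P)) = 2"
    by blast
  interpret P: primeideal P R by fact
  have two: "x \<in> P \<or> x \<ominus> \<one> \<in> P" if "x \<in> carrier R" for x
    using card_quot_eq_2_iff(1)[OF P.is_ideal P.I_notcarr[symmetric]] P(3) that by simp
  let ?U = "((+>) I) ` P"
  \<comment> \<open>Because \<open>I \<subseteq> P\<close>, membership in \<open>P\<close> depends
    only on the class modulo \<open>I\<close>, so the colour is well defined.\<close>
  have U_iff: "I +> x \<in> ?U \<longleftrightarrow> x \<in> P" if x: "x \<in> carrier R" for x
  proof
    assume "I +> x \<in> ?U"
    then obtain y where y: "y \<in> P" "I +> x = I +> y" by blast
    have yR: "y \<in> carrier R" using P.Icarr[OF y(1)] .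
    have "x \<ominus> y \<in> P"
      using quotient_eq_iff_same_a_r_cos[OF I(1) x yR] y(2) P(2) by blast
    then show "x \<in> P"
      using ideal_minus_mem_iff[OF P.is_ideal x yR] y(1) by blast
  qed blast
  have diff: "(A \<in> ?U) \<noteq> (B \<in> ?U)" if AB: "(A, B) \<in> parcs ?G" for A B
  proof -
    obtain x y where x: "x \<in> carrier R" "A = I +> x" and y: "y \<in> carrier R" "B = I +> y"
      using AB by (auto simp: unitary_cayley_graph_def carrier_quot)
    have "I +> (x \<ominus> y) \<in> Units (R Quot I)"
      using AB x y by (simp add: unitary_cayley_graph_def rcos_minus[OF I(1)])
    then have "x \<ominus> y \<notin> P"
      using quot_unit_iff[OF I(1), of "x \<ominus> y"] P x(1) y(1) by auto
    moreover have "x \<ominus> y \<in> P" if "x \<in> P" "y \<in> P"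
      using ideal_minus_closed[OF P.is_ideal] that by blast
    \<comment> \<open>With only two residues, both elements are 1 modulo \<open>P\<close>.\<close>
    moreover have "x \<ominus> y \<in> P" if "x \<notin> P" "y \<notin> P"
    proof -
      have "x \<ominus> y = (x \<ominus> \<one>) \<ominus> (y \<ominus> \<one>)"
        using x(1) y(1) by algebra
      then show ?thesis
        using ideal_minus_closed[OF P.is_ideal] two[OF x(1)] two[OF y(1)] that by simp
    qed
    ultimately show ?thesis
      using U_iff x y by blast
  qed
  have sub: "?U \<subseteq> carrier (R Quot I)"
    unfolding carrier_quot using P.a_subset by blast
  let ?V = "carrier (R Quot I) - ?U"
  show "bipartite (with_proj ?G)"
    unfolding bipartite_def
  proof (intro exI conjI ballI)
    show "verts (with_proj ?G) = ?U \<union> ?V"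
      using sub by (simp add: unitary_cayley_graph_def Un_absorb1)
    show "?U \<inter> ?V = {}" by (rule Diff_disjoint)
    fix e assume "e \<in> arcs (with_proj ?G)"
    then obtain A B where e: "e = (A, B)" and AB: "(A, B) \<in> parcs ?G"
      by (cases e) simp
    have "A \<in> carrier (R Quot I)" "B \<in> carrier (R Quot I)"
      using AB by (simp_all add: unitary_cayley_graph_def)
    then show "tail (with_proj ?G) e \<in> ?U \<and> head (with_proj ?G) e \<in> ?V \<or>
      tail (with_proj ?G) e \<in> ?V \<and> head (with_proj ?G) e \<in> ?U"
      using diff[OF AB] unfolding e with_proj_simps fst_conv snd_conv by (simp only: Diff_iff simp_thms)
  qed
qed

theorem theorem4p2:
  fixes R :: "('a, 'm) ring_scheme" (structure) and I :: "'a set"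
  assumes "dedekind_domain R"
    and "ideal I R" and "I \<noteq> {\<zero>}"
    and "finite (carrier (R Quot I))"
    and "carrier (R Quot I) \<noteq> {\<zero>\<^bsub>R Quot I\<^esub>}"
  shows "bipartite (with_proj (unitary_cayley_graph (R Quot I))) \<longleftrightarrow> min_prime_norm R I = 2"
proof -
  interpret dedekind_domain R by fact
  interpret I: ideal I R by fact
  interpret h: ring_hom_ring R "R Quot I" "(+>) I"
    by (rule I.rcos_ring_hom_ring)
  let ?N = "\<lambda>n. \<exists>P. primeideal P R \<and> I \<subseteq> P \<and> n = card (carrier (R Quot P))"
  \<comment> \<open>The congruence rule supplies primality of \<open>P\<close> for rewriting
    divisibility into containment.\<close>
  have norm: "min_prime_norm R I = (LEAST n. ?N n)"
    unfolding min_prime_norm_def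
    by (simp add: prime_divides_iff_contains[OF _ assms(2,3)] cong: conj_cong)
  \<comment> \<open>Nontriviality of \<open>R / I\<close> ensures a prime above \<open>I\<close>, so
    the minimum ranges over a nonempty set.\<close>
  have "I \<noteq> carrier R"
  proof
    assume eq: "I = carrier R"
    have "I +> x = I +> \<zero>" if "x \<in> carrier R" for x
      using quotient_eq_iff_same_a_r_cos[OF assms(2), of x \<zero>] that eq by auto
    moreover have "I +> \<zero> = \<zero>\<^bsub>R Quot I\<^esub>"
      by simp
    ultimately show False
      using assms(5) unfolding carrier_quot by auto
  qed
  then obtain M where "maximalideal M R" "I \<subseteq> M"
    using exists_maximalideal[OF assms(2)] by blast
  then have "\<exists>n. ?N n"
    using maximalideal_prime by blast
  then have least: "?N (LEAST n. ?N n)"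
    by (rule LeastI_ex)
  have ge: "2 \<le> n" if "?N n" for n
  proof -
    obtain P where P: "primeideal P R" "I \<subseteq> P" and n: "n = card (carrier (R Quot P))"
      using \<open>?N n\<close> by blast
    interpret P: primeideal P R by fact
    show ?thesis
      unfolding n using finite_quot_mono[OF assms(2) P.is_ideal P(2) assms(4)]
      by (rule card_quot_eq_2_iff(2)[OF P.is_ideal P.I_notcarr[symmetric]])
  qed
  \<comment> \<open>Since 2 is a lower bound for all norms, the minimum equals 2 exactly when 2 is
    attained.\<close>
  have "min_prime_norm R I = 2 \<longleftrightarrow> ?N 2"
    unfolding norm
  proof
    assume "(LEAST n. ?N n) = 2"
    with least show "?N 2" by (simp only:)
  next
    assume "?N 2"
    then show "(LEAST n. ?N n) = 2"
      by (rule Least_equality) (rule ge)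
  qed
  also have "\<dots> \<longleftrightarrow> bipartite (with_proj (unitary_cayley_graph (R Quot I)))"
    unfolding bipartite_quot_iff[OF assms(2-4)] by (simp only: eq_commute[of 2])
  finally show ?thesis by (rule sym)
qed

end
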